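(* Let $p$ be a prime and let $q$ be a power of $p$. Let $G = A \times B$, where $A$ is an Abelian group of exponent $k$ dividing $q-1$, and $B$ is a finite $p$-group. Let $V$ be a finite-dimensional vector space over $\mathbb{F}_q$ and let $(\rho, V)$ be a representation of $G$. Then $h_{G,\rho}(V) = 0$.
   Context: For a representation $\rho: G \to \mathrm{GL}(V)$ of a group $G$ on a vector space $V$, a subspace $U \le V$ is $(G,\rho)$-covering if $\bigcup_{g\in G} \rho(g)(U) = V$, where $\rho(g)(U)=\{\rho(g)(u): u \in U\}$. $h_{G,\rho}(V)$ denotes the maximum possible codimension of a $(G,\rho)$-covering subspace of $V$. *)

theory Defs
  imports Complex_Main "HOL-Computational_Algebra.Primes" "HOL-Algebra.Coset"
begin

text \<open>The exponent is the least positive \<open>n\<close> with \<open>x\<^sup>n = 1\<close> for all \<open>x\<close>. The value \<open>0\<close> stands for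
  infinite exponent.\<close>

definition group_exponent :: "('g, 'm) monoid_scheme \<Rightarrow> nat" where
  "group_exponent G =
     (if \<exists>n::nat>0. \<forall>x\<in>carrier G. x [^]\<^bsub>G\<^esub> n = \<one>\<^bsub>G\<^esub>
      then LEAST n::nat. n > 0 \<and> (\<forall>x\<in>carrier G. x [^]\<^bsub>G\<^esub> n = \<one>\<^bsub>G\<^esub>)
      else 0)"

definition finite_p_group :: "nat \<Rightarrow> ('g, 'm) monoid_scheme \<Rightarrow> bool" where
  "finite_p_group p G \<longleftrightarrow> group G \<and> finite (carrier G) \<and> (\<exists>m. order G = p ^ m)"

text \<open>As in \<^theory>\<open>HOL.Vector_Spaces\<close>, a vector space is a type \<open>'v\<close> with a scalar multiplication
  \<open>scale\<close> by elements of the field \<open>'k\<close>, so its underlying set is \<open>UNIV\<close>.\<close>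

definition GL :: "('k::field \<Rightarrow> 'v::ab_group_add \<Rightarrow> 'v) \<Rightarrow> ('v \<Rightarrow> 'v) monoid" where
  "GL scale = \<lparr>carrier = {f. Vector_Spaces.linear scale scale f \<and> bij f}, mult = (\<circ>), one = id\<rparr>"

lemma GL_group:
  assumes "vector_space scale"
  shows "group (GL scale)"
proof -
  interpret vector_space scale by fact
  interpret vector_space_pair scale scale by unfold_locales
  show ?thesis
  proof (rule groupI)
    fix f assume f: "f \<in> carrier (GL scale)"
    then have b: "bij f" and l: "Vector_Spaces.linear scale scale f" by (auto simp: GL_def)
    interpret f: Vector_Spaces.linear scale scale f by fact
    have "Vector_Spaces.linear scale scale (inv_into UNIV f)"
      unfolding Vector_Spaces.linear_iff
    proof (intro conjI allI)
      show "vector_space scale" "vector_space scale" by fact+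
      note inv = surj_f_inv_f[OF bij_is_surj[OF b]] inv_f_f[OF bij_is_inj[OF b]]
      show "inv_into UNIV f (x + y) = inv_into UNIV f x + inv_into UNIV f y" for x y
        using inv f.add by metis
      show "inv_into UNIV f (scale c x) = scale c (inv_into UNIV f x)" for c x
        using inv f.scale by metis
    qed
    moreover have "inv_into UNIV f \<circ> f = id" using b by (simp add: bij_is_inj)
    ultimately show "\<exists>g\<in>carrier (GL scale). g \<otimes>\<^bsub>GL scale\<^esub> f = \<one>\<^bsub>GL scale\<^esub>"
      using b by (auto simp: GL_def bij_imp_bij_inv)
  qed (auto simp: GL_def bij_comp linear_id Vector_Spaces.linear_compose comp_assoc)
qed

definition covering_subspace ::
  "('k::field \<Rightarrow> 'v::ab_group_add \<Rightarrow> 'v) \<Rightarrow> ('g, 'm) monoid_scheme \<Rightarrow> ('g \<Rightarrow> 'v \<Rightarrow> 'v) \<Rightarrow> 'v set \<Rightarrow> bool"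
  where
  "covering_subspace scale G \<rho> U \<longleftrightarrow>
     module.subspace scale U \<and> (\<Union>g\<in>carrier G. \<rho> g ` U) = UNIV"

definition codim :: "('k::field \<Rightarrow> 'v::ab_group_add \<Rightarrow> 'v) \<Rightarrow> 'v set \<Rightarrow> nat" where
  "codim scale U = vector_space.dim scale UNIV - vector_space.dim scale U"

definition max_covering_codim ::
  "('k::field \<Rightarrow> 'v::ab_group_add \<Rightarrow> 'v) \<Rightarrow> ('g, 'm) monoid_scheme \<Rightarrow> ('g \<Rightarrow> 'v \<Rightarrow> 'v) \<Rightarrow> nat" where
  "max_covering_codim scale G \<rho> = Max (codim scale ` {U. covering_subspace scale G \<rho> U})"

text \<open>The maximum is taken over a finite nonempty set.\<close>

lemma finite_covering_codims: "finite (codim scale ` {U. covering_subspace scale G \<rho> U})"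
  by (rule finite_subset[of _ "{..vector_space.dim scale UNIV}"]) (auto simp: codim_def)

lemma covering_subspace_UNIV:
  assumes "vector_space scale" "group G" "\<rho> \<in> hom G (GL scale)"
  shows "covering_subspace scale G \<rho> UNIV"
proof -
  interpret vector_space scale by fact
  have "\<one>\<^bsub>G\<^esub> \<in> carrier G" using assms(2) by (simp add: group.is_monoid)
  moreover from this have "\<rho> \<one>\<^bsub>G\<^esub> ` UNIV = UNIV"
    using assms(3) by (auto simp: hom_def GL_def bij_def Pi_iff)
  ultimately show ?thesis by (auto simp: covering_subspace_def subspace_UNIV)
qed

end

(* Suppose that U is a proper covering subspace, let N be the largest G-stable subspace of U, and let
   S be a minimal G-stable subspace properly containing N. The p-group B has a nonzero fixed point in
   S/N, so by minimality it acts trivially there. Each a in A satisfies a^(q-1) = 1, hence has an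
   eigenvector in S/N, so by minimality it acts there as a nonzero scalar. Thus for v in S - N every
   g v is a nonzero multiple of v modulo N, so g v lies in U if and only if v does. As v is not in N,
   the orbit of v avoids U, a contradiction. *)

theory Submission
  imports "HOL-Computational_Algebra.Polynomial" Defs
    "HOL-Algebra.Group_Action" "HOL-Algebra.Multiplicative_Group"
begin

section \<open>Power sums over a finite field\<close>

text \<open>Multiplication by \<open>c\<close> permutes the nonzero elements, so it preserves their
  product; that product is nonzero and can be cancelled.\<close>

lemma power_card_minus_one_eq_1:
  fixes c :: "'k::{field,finite}"
  assumes "c \<noteq> 0"
  shows "c ^ (card (UNIV :: 'k set) - 1) = 1"
proof -
  have "(\<Prod>x\<in>UNIV - {0}. c * x) = \<Prod>(UNIV - {0} :: 'k set)"
    by (rule prod.reindex_bij_witness[of _ "\<lambda>x. x / c" "\<lambda>x. c * x"]) (use assms in auto)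
  then have "c ^ card (UNIV - {0} :: 'k set) * \<Prod>(UNIV - {0} :: 'k set) = \<Prod>(UNIV - {0})"
    by (simp add: prod.distrib)
  then show ?thesis by (simp add: card_Diff_singleton)
qed

text \<open>The translation by 1 permutes the field, so adding 1 to every element leaves the sum of
  all elements unchanged.\<close>

lemma of_nat_card_eq_0: "of_nat (card (UNIV :: 'k::{field,finite} set)) = (0 :: 'k)"
proof -
  have "(\<Sum>x\<in>UNIV. x + 1 :: 'k) = \<Sum>UNIV"
    by (rule sum.reindex_bij_witness[of _ "\<lambda>x. x - 1" "\<lambda>x. x + 1"]) auto
  then show ?thesis by (simp add: sum.distrib)
qed

text \<open>The polynomial x^i - 1 has too few roots to vanish at every nonzero element, so some
  nonzero \<open>d\<close> has \<open>d ^ i \<noteq> 1\<close>. Multiplication by \<open>d\<close>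
  permutes the nonzero elements and multiplies the sum by \<open>d ^ i\<close>.\<close>

lemma sum_powers_nonzero_eq_0:
  assumes "0 < i" "i < card (UNIV :: 'k::{field,finite} set) - 1"
  shows "(\<Sum>c\<in>UNIV - {0 :: 'k}. c ^ i) = 0"
proof -
  let ?f = "Polynomial.monom (1 :: 'k) i - 1"
  have "Polynomial.coeff ?f i = 1" using assms(1) by simp
  then have nz: "?f \<noteq> 0" by (metis coeff_0 zero_neq_one)
  have "degree ?f \<le> i" by (rule degree_diff_le) (simp_all add: degree_monom_le)
  then have "card {x. poly ?f x = 0} < card (UNIV - {0} :: 'k set)"
    using card_poly_roots_bound[OF nz] assms(2) by (simp add: card_Diff_singleton)
  then have "\<not> UNIV - {0} \<subseteq> {x. poly ?f x = 0}" by (metis card_mono finite leD)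
  then obtain d :: 'k where d: "d \<noteq> 0" "d ^ i \<noteq> 1" by (auto simp: poly_monom)
  have "(\<Sum>c\<in>UNIV - {0 :: 'k}. (d * c) ^ i) = (\<Sum>c\<in>UNIV - {0}. c ^ i)"
    by (rule sum.reindex_bij_witness[of _ "\<lambda>x. x / d" "\<lambda>x. d * x"]) (use d in auto)
  then have "d ^ i * (\<Sum>c\<in>UNIV - {0 :: 'k}. c ^ i) = (\<Sum>c\<in>UNIV - {0}. c ^ i)"
    by (simp add: power_mult_distrib sum_distrib_left)
  then show ?thesis using d(2) by simp
qed

section \<open>Fixed points of p-group actions\<close>

text \<open>The points that are not fixed are partitioned into the orbits of size other than 1. The
  size of each such orbit divides \<open>p ^ m\<close>, hence is a multiple of
  \<open>p\<close>.\<close>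

lemma (in group_action) p_dvd_card_non_fixed_points:
  assumes "prime p" "order G = p ^ m" "finite E"
  shows "p dvd card (E - {x \<in> E. \<forall>g\<in>carrier G. \<phi> g x = x})"
proof -
  let ?F = "{x \<in> E. \<forall>g\<in>carrier G. \<phi> g x = x}"
  let ?C = "{R \<in> orbits G E \<phi>. card R \<noteq> 1}"
  have orbit_sub: "orbit G \<phi> x \<subseteq> E" if "x \<in> E" for x
    using that element_image by (auto simp: orbit_def)
  have fix_iff: "card (orbit G \<phi> x) = 1 \<longleftrightarrow> x \<in> ?F" if x: "x \<in> E" for x
  proof
    assume "card (orbit G \<phi> x) = 1"
    then have "orbit G \<phi> x = {x}" using orbit_refl[OF x] by (metis card_1_singletonE singletonD)
    then show "x \<in> ?F" using x by (auto simp: orbit_def)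
  next
    assume "x \<in> ?F"
    then have "orbit G \<phi> x = {x}" using orbit_refl[OF x] by (auto simp: orbit_def)
    then show "card (orbit G \<phi> x) = 1" by simp
  qed
  have "E - ?F = \<Union>?C"
  proof (intro equalityI subsetI)
    fix x assume "x \<in> E - ?F"
    then show "x \<in> \<Union>?C" using fix_iff[of x] orbit_refl[of x] by (auto simp: orbits_def)
  next
    fix x assume "x \<in> \<Union>?C"
    then obtain y where y: "y \<in> E" "card (orbit G \<phi> y) \<noteq> 1" "x \<in> orbit G \<phi> y"
      by (auto simp: orbits_def)
    then have x: "x \<in> E" using orbit_sub by blast
    have "orbit G \<phi> x = orbit G \<phi> y"
      using disjoint_union[of "orbit G \<phi> x" "orbit G \<phi> y"] x y orbit_refl[OF x]
      by (auto simp: orbits_def)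
    then show "x \<in> E - ?F" using fix_iff[OF x] x y(2) by auto
  qed
  moreover have "p dvd card (\<Union>?C)"
  proof (rule dvd_partition)
    show "finite (\<Union>?C)" using assms(3) orbits_coverture by (auto intro: finite_subset)
    show "\<forall>R\<in>?C. p dvd card R"
    proof
      fix R assume R: "R \<in> ?C"
      then obtain x where x: "x \<in> E" "R = orbit G \<phi> x" by (auto simp: orbits_def)
      have "card R dvd p ^ m"
        using orbit_stabilizer_theorem[OF x(1)] x(2) assms(2) by (metis dvd_triv_left)
      then obtain j where "card R = p ^ j" using assms(1) divides_primepow_nat by blast
      then show "p dvd card R" using R by (cases j) auto
    qed
    show "\<forall>R1\<in>?C. \<forall>R2\<in>?C. R1 \<noteq> R2 \<longrightarrow> R1 \<inter> R2 = {}" using disjoint_union by blast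
  qed
  ultimately show ?thesis by simp
qed

text \<open>Every vector is given by its coordinates in \<open>Basis\<close>, and there are finitely
  many coordinate functions.\<close>

lemma (in finite_dimensional_vector_space) finite_UNIV_if_finite_field:
  assumes "finite (UNIV :: 'a set)"
  shows "finite (UNIV :: 'b set)"
proof -
  have UNIV_eq: "(UNIV :: 'b set) = (\<lambda>u. \<Sum>v\<in>Basis. scale (u v) v) ` PiE Basis (\<lambda>_. UNIV)"
  proof (intro equalityI subsetI)
    fix x :: 'b
    have "x \<in> span Basis" by (simp add: span_Basis)
    then obtain u where u: "x = (\<Sum>v\<in>Basis. scale (u v) v)"
      by (auto simp: span_finite[OF finite_Basis])
    \<comment> \<open>Members of \<open>PiE\<close> must be undefined outside \<open>Basis\<close>,
      hence the restriction.\<close>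
    then have "x = (\<Sum>v\<in>Basis. scale (restrict u Basis v) v)" by simp
    then show "x \<in> (\<lambda>u. \<Sum>v\<in>Basis. scale (u v) v) ` PiE Basis (\<lambda>_. UNIV)"
      by (rule image_eqI[of _ _ "restrict u Basis"]) auto
  qed simp
  have "finite (PiE Basis (\<lambda>_. UNIV :: 'a set))"
    using assms finite_Basis by (intro finite_PiE) auto
  from finite_subset[OF equalityD1[OF UNIV_eq] finite_imageI[OF this]] show ?thesis .
qed

section \<open>Eigenvectors of a map whose (q-1)-th power is the identity\<close>

text \<open>Such a \<open>T\<close> is a root of X^(q-1) - 1, which has distinct linear factors over
  the field. So \<open>s\<close> is a sum of eigenvectors in \<open>S\<close>, and they cannot all
  lie in \<open>N\<close>. The eigenvector equation holds exactly, not just modulo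
  \<open>N\<close>.\<close>

lemma eigenvector_outside_subspace:
  fixes scale :: "'k::{field, finite} \<Rightarrow> 'v::ab_group_add \<Rightarrow> 'v"
  assumes T: "Vector_Spaces.linear scale scale T"
    and S: "module.subspace scale S" "\<And>v. v \<in> S \<Longrightarrow> T v \<in> S"
    and N: "module.subspace scale N"
    and pow: "\<And>v. (T ^^ (card (UNIV :: 'k set) - 1)) v = v"
    and s: "s \<in> S" "s \<notin> N"
  obtains c w where "c \<noteq> 0" "w \<in> S" "w \<notin> N" "T w = scale c w"
proof -
  interpret vector_space scale using T by (simp add: Vector_Spaces.linear_iff)
  interpret T: Vector_Spaces.linear scale scale T by fact
  define r where "r = card (UNIV :: 'k set) - 1"
  have "card {0, 1 :: 'k} \<le> card (UNIV :: 'k set)" by (rule card_mono) auto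
  then have r0: "r > 0" by (simp add: r_def)
  have r1: "of_nat r = (-1 :: 'k)"
    using of_nat_card_eq_0[where ?'k = 'k] r0 unfolding r_def by (simp add: of_nat_diff)
  \<comment> \<open>\<open>e c\<close> is an eigenvector of \<open>T\<close> for \<open>1/c\<close> unless it vanishes, and the \<open>e c\<close> add up to \<open>-s\<close>\<close>
  define e where "e c = (\<Sum>i<r. scale (c ^ i) ((T ^^ i) s))" for c
  have eS: "e c \<in> S" for c
  proof -
    have "(T ^^ i) s \<in> S" for i by (induction i) (use s S in auto)
    then show ?thesis by (auto simp: e_def intro!: subspace_sum subspace_scale S)
  qed
  have eig: "T (e c) = scale (inverse c) (e c)" if c: "c \<noteq> 0" for c
  proof -
    let ?f = "\<lambda>i. scale (c ^ i) ((T ^^ i) s)"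
    \<comment> \<open>Applying \<open>T\<close> and multiplying by \<open>c\<close> shifts the
      summands by one. The sum closes up cyclically because \<open>c ^ r = 1\<close> and
      \<open>T ^^ r\<close> fixes \<open>s\<close>.\<close>
    have "scale c (T (e c)) = (\<Sum>i<r. ?f (Suc i))"
      by (simp add: e_def T.sum T.scale scale_sum_right)
    also have "\<dots> = (\<Sum>i<Suc r. ?f i) - ?f 0" by (subst sum.lessThan_Suc_shift) simp
    also have "\<dots> = e c + ?f r - ?f 0" by (simp add: e_def)
    also have "?f r = ?f 0" using pow power_card_minus_one_eq_1[OF c] by (simp add: r_def)
    finally have "scale c (T (e c)) = e c" by simp
    then show ?thesis using c by (metis left_inverse scale_one scale_scale)
  qed
  have "(\<Sum>c\<in>UNIV - {0}. e c) = (\<Sum>i<r. scale (\<Sum>c\<in>UNIV - {0}. c ^ i) ((T ^^ i) s))"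
    unfolding e_def by (subst sum.swap) (simp add: scale_sum_left)
  \<comment> \<open>The power sums vanish for \<open>0 < i < r\<close>; for \<open>i = 0\<close> the
    sum counts the nonzero scalars, giving \<open>r\<close>, which is -1 in the field.\<close>
  also have "\<dots> = (\<Sum>i<r. if i = 0 then scale (of_nat r) s else 0)"
    by (rule sum.cong)
       (auto simp: r_def card_Diff_singleton sum_powers_nonzero_eq_0 simp del: of_nat_diff)
  also have "\<dots> = - s" using r0 r1 by simp
  finally have "(\<Sum>c\<in>UNIV - {0}. e c) = - s" .
  then have "(\<Sum>c\<in>UNIV - {0}. e c) \<notin> N" using s N subspace_neg by fastforce
  then obtain c where c: "c \<noteq> 0" "e c \<notin> N" using subspace_sum[OF N, of "UNIV - {0}" e] by blast
  then show ?thesis using that[of "inverse c" "e c"] eS eig by auto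
qed

section \<open>Fixed points of a p-group on a quotient space\<close>

text \<open>\<open>B\<close> permutes the cosets of \<open>N\<close> in \<open>S\<close>, whose
  number is a multiple of \<open>p\<close>, so the number of fixed cosets is a multiple of
  \<open>p\<close> too. The coset \<open>N\<close> is fixed, hence there is another one.\<close>

lemma p_group_fixed_coset:
  fixes scale :: "'k::field \<Rightarrow> 'v::ab_group_add \<Rightarrow> 'v"
  assumes "vector_space scale" "prime p" "of_nat p = (0 :: 'k)"
    and B: "group B" "order B = p ^ m" and \<rho>: "\<rho> \<in> hom B (GL scale)"
    and S: "module.subspace scale S" "finite S" "\<And>b v. b \<in> carrier B \<Longrightarrow> v \<in> S \<Longrightarrow> \<rho> b v \<in> S"
    and N: "module.subspace scale N" "N \<subset> S" "\<And>b v. b \<in> carrier B \<Longrightarrow> v \<in> N \<Longrightarrow> \<rho> b v \<in> N"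
  obtains v where "v \<in> S" "v \<notin> N" "\<And>b. b \<in> carrier B \<Longrightarrow> \<rho> b v - v \<in> N"
proof -
  interpret vector_space scale by fact
  interpret B: group B by fact
  \<comment> \<open>The additive group of \<open>S\<close>, recast so that quotient groups and the
    divisibility of their order by element orders apply.\<close>
  define M where "M = \<lparr>carrier = S, mult = (+), one = 0 :: 'v\<rparr>"
  have carrier_M: "carrier M = S" by (simp add: M_def)
  interpret M: comm_group M
    by (rule comm_groupI)
       (use S(1) in \<open>auto simp: M_def subspace_add subspace_0 add_ac
          intro!: bexI[of _ "- x" for x] subspace_neg\<close>)
  have inv: "inv\<^bsub>M\<^esub> x = - x" if "x \<in> S" for x
    by (rule M.inv_equality) (use that S(1) in \<open>auto simp: M_def subspace_neg\<close>)
  have "subgroup N M"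
    by (rule M.subgroupI) (use N(1,2) inv in \<open>auto simp: M_def subspace_add subspace_neg
       dest: subspace_0 subsetD[OF psubset_imp_subset]\<close>)
  then interpret N: normal N M by (rule M.subgroup_imp_normal)
  interpret Q: group "M Mod N" by (rule N.factorgroup_is_group)
  define X where "X = carrier (M Mod N)"
  have coset: "N #>\<^bsub>M\<^esub> s = {t. t - s \<in> N}" for s
    unfolding r_coset_def by (auto simp: M_def)
  have X: "X = (\<lambda>s. {t. t - s \<in> N}) ` S"
    by (simp add: X_def carrier_FactGroup coset carrier_M)
  have finX: "finite X" using S(2) by (simp add: X)
  have coset_eq: "{t. t - s \<in> N} = {t. t - s' \<in> N} \<longleftrightarrow> s - s' \<in> N" for s s'
  proof
    assume "{t. t - s \<in> N} = {t. t - s' \<in> N}"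
    then show "s - s' \<in> N" using subspace_0[OF N(1)] by (metis diff_self mem_Collect_eq)
  next
    assume *: "s - s' \<in> N"
    have "t - s \<in> N \<longleftrightarrow> t - s' \<in> N" for t
      using subspace_add[OF N(1) _ *, of "t - s"] subspace_diff[OF N(1) _ *, of "t - s'"] by auto
    then show "{t. t - s \<in> N} = {t. t - s' \<in> N}" by simp
  qed
  have p_dvd: "p dvd card X"
  proof -
    \<comment> \<open>The coset of \<open>s\<close> is nontrivial and is killed by \<open>p\<close>,
      since \<open>p\<close> is zero in the field; so it has order \<open>p\<close> in the
      quotient.\<close>
    obtain s where s: "s \<in> S" "s \<notin> N" using N(2) by blast
    define x where "x = N #>\<^bsub>M\<^esub> s"
    have x: "x \<in> carrier (M Mod N)" using s by (auto simp: x_def carrier_FactGroup M_def)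
    have pow: "s [^]\<^bsub>M\<^esub> i = scale (of_nat i) s" for i :: nat
      by (induction i) (auto simp: M_def scale_left_distrib add_ac)
    have "x [^]\<^bsub>M Mod N\<^esub> p = N #>\<^bsub>M\<^esub> (s [^]\<^bsub>M\<^esub> p)"
      unfolding x_def using s by (simp add: N.FactGroup_pow carrier_M)
    also have "\<dots> = \<one>\<^bsub>M Mod N\<^esub>" unfolding pow using assms(3) by (simp add: coset)
    finally have "Q.ord x dvd p" using Q.pow_eq_id[OF x] by simp
    moreover have "x \<noteq> \<one>\<^bsub>M Mod N\<^esub>"
      using s coset_eq[of s 0] by (auto simp: x_def coset)
    then have "Q.ord x \<noteq> 1" using Q.ord_eq_1[OF x] by simp
    ultimately have "Q.ord x = p" using assms(2) by (metis prime_nat_iff)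
    then show ?thesis using Q.ord_dvd_group_order[OF x] by (simp add: order_def X_def)
  qed
  have lin: "Vector_Spaces.linear scale scale (\<rho> b)" "bij (\<rho> b)" if "b \<in> carrier B" for b
    using \<rho> that by (auto simp: hom_def GL_def)
  have mult: "\<rho> (b \<otimes>\<^bsub>B\<^esub> b') v = \<rho> b (\<rho> b' v)" if "b \<in> carrier B" "b' \<in> carrier B" for b b' v
    using \<rho> that by (auto simp: hom_def GL_def)
  \<comment> \<open>Membership in \<open>hom\<close> only gives multiplicativity. The identity is
    sent to an injective idempotent map, which must be \<open>id\<close>.\<close>
  have one: "\<rho> \<one>\<^bsub>B\<^esub> v = v" for v
    using mult[of "\<one>\<^bsub>B\<^esub>" "\<one>\<^bsub>B\<^esub>" v] lin(2)[OF B.one_closed] by (simp add: bij_is_inj inj_eq)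
  have N_iff: "\<rho> b v \<in> N \<longleftrightarrow> v \<in> N" if b: "b \<in> carrier B" for b v
    using N(3)[OF b] N(3)[OF B.inv_closed[OF b], of "\<rho> b v"] mult[of "inv\<^bsub>B\<^esub> b" b v] one b by auto
  have img: "\<rho> b ` {t. t - s \<in> N} = {t. t - \<rho> b s \<in> N}" if b: "b \<in> carrier B" for b s
  proof -
    interpret L: Vector_Spaces.linear scale scale "\<rho> b" by (rule lin[OF b])
    have diff: "\<rho> b u - \<rho> b s \<in> N \<longleftrightarrow> u - s \<in> N" for u
      using N_iff[OF b, of "u - s"] by (simp add: L.diff)
    have "t \<in> \<rho> b ` {t. t - s \<in> N}" if t: "t - \<rho> b s \<in> N" for t
    proof -
      obtain u where "t = \<rho> b u" using lin(2)[OF b] by (metis bij_is_surj surjD)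
      then show ?thesis using t diff by auto
    qed
    then show ?thesis using diff by auto
  qed
  \<comment> \<open>Elements of \<open>Bij X\<close> are extensional, so the induced map on cosets
    is restricted to \<open>X\<close>.\<close>
  define \<phi> where "\<phi> b = restrict ((`) (\<rho> b)) X" for b
  have \<phi>X: "\<phi> b Y \<in> X" if "b \<in> carrier B" "Y \<in> X" for b Y
    using that S(3) by (auto simp: \<phi>_def X img)
  have \<phi>m: "\<phi> (b \<otimes>\<^bsub>B\<^esub> b') Y = \<phi> b (\<phi> b' Y)"
    if "b \<in> carrier B" "b' \<in> carrier B" "Y \<in> X" for b b' Y
    using \<phi>X[OF that(2,3)] that by (auto simp: \<phi>_def image_image mult)
  have \<phi>1: "\<phi> \<one>\<^bsub>B\<^esub> Y = Y" if "Y \<in> X" for Y using that by (simp add: \<phi>_def one)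
  have bij: "\<phi> b \<in> Bij X" if b: "b \<in> carrier B" for b
  proof -
    have "bij_betw (\<phi> b) X X"
      by (rule bij_betwI[of _ _ _ "\<phi> (inv\<^bsub>B\<^esub> b)"]) (use b \<phi>X in \<open>auto simp flip: \<phi>m simp: \<phi>1\<close>)
    then show ?thesis by (auto simp: Bij_def \<phi>_def)
  qed
  have \<phi>_hom: "\<phi> \<in> hom B (BijGroup X)"
  proof (rule homI)
    fix b b' assume b: "b \<in> carrier B" "b' \<in> carrier B"
    show "\<phi> (b \<otimes>\<^bsub>B\<^esub> b') = \<phi> b \<otimes>\<^bsub>BijGroup X\<^esub> \<phi> b'"
      using b bij \<phi>m[OF b] by (auto simp: BijGroup_def compose_def fun_eq_iff) (auto simp: \<phi>_def)
  qed (use bij in \<open>auto simp: BijGroup_def\<close>)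
  interpret group_action B X \<phi>
    by (intro group_action.intro group_hom.intro group_hom_axioms.intro B.is_group group_BijGroup \<phi>_hom)
  let ?F = "{x \<in> X. \<forall>g\<in>carrier B. \<phi> g x = x}"
  have non_fixed: "p dvd card (X - ?F)" using p_dvd_card_non_fixed_points[OF assms(2) B(2) finX] .
  have "card X = card (X - ?F) + card ?F"
    using finX card_Diff_subset[of ?F X] card_mono[OF finX, of ?F] by (auto intro: finite_subset)
  then have "p dvd card ?F" using p_dvd dvd_add_right_iff[OF non_fixed, of "card ?F"] by simp
  moreover have "N \<in> ?F"
  proof -
    have "N \<in> X" unfolding X by (rule image_eqI[of _ _ 0]) (simp_all add: subspace_0[OF S(1)])
    moreover have "\<rho> b 0 = 0" if "b \<in> carrier B" for b
    proof -
      interpret L: Vector_Spaces.linear scale scale "\<rho> b" by (rule lin[OF that])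
      show ?thesis by (rule L.zero)
    qed
    ultimately show ?thesis using img[of _ 0] by (auto simp: \<phi>_def)
  qed
  \<comment> \<open>A singleton is excluded because \<open>p\<close> does not divide 1.\<close>
  ultimately have "?F \<noteq> {N}" using assms(2) by (auto simp: not_prime_unit)
  then obtain Y where Y: "Y \<in> ?F" "Y \<noteq> N" using \<open>N \<in> ?F\<close> by blast
  then obtain v where v: "v \<in> S" "Y = {t. t - v \<in> N}" by (auto simp: X)
  have "v \<notin> N" using Y(2) coset_eq[of v 0] v(2) by auto
  moreover have "\<rho> b v - v \<in> N" if b: "b \<in> carrier B" for b
    using Y(1) b v img[OF b, of v] coset_eq[of "\<rho> b v" v] by (auto simp: \<phi>_def)
  ultimately show ?thesis using that v(1) by blast
qed

text \<open>The value 0, which encodes infinite exponent, cannot divide the positive number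
  \<open>r\<close>; so the exponent is a genuine one.\<close>

lemma group_exponent_pow_eq_one:
  assumes "group G" "group_exponent G dvd r" "r > 0" "x \<in> carrier G"
  shows "x [^]\<^bsub>G\<^esub> r = \<one>\<^bsub>G\<^esub>"
proof -
  interpret group G by fact
  let ?P = "\<lambda>n::nat. n > 0 \<and> (\<forall>x\<in>carrier G. x [^]\<^bsub>G\<^esub> n = \<one>\<^bsub>G\<^esub>)"
  have nz: "group_exponent G \<noteq> 0" using assms(2,3) by auto
  then have ex: "\<exists>n. ?P n" by (auto simp: group_exponent_def split: if_splits)
  then have "group_exponent G = (LEAST n. ?P n)" by (auto simp: group_exponent_def)
  then have "x [^]\<^bsub>G\<^esub> group_exponent G = \<one>\<^bsub>G\<^esub>" using LeastI_ex[OF ex] assms(4) by simp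
  moreover obtain j where "r = group_exponent G * j" using assms(2) by blast
  ultimately show ?thesis using assms(4) by (metis nat_pow_one nat_pow_pow)
qed

section \<open>No proper subspace is covering\<close>

theorem theorem5p2:
  fixes p q n k :: nat
    and A :: "('a, 'm) monoid_scheme" and B :: "('b, 'l) monoid_scheme"
    and scale :: "'k::{field, finite} \<Rightarrow> 'v::ab_group_add \<Rightarrow> 'v" and Basis :: "'v set"
    and \<rho> :: "'a \<times> 'b \<Rightarrow> 'v \<Rightarrow> 'v"
  assumes "prime p" and "n > 0" and "q = p ^ n" and "card (UNIV :: 'k set) = q"
    and "comm_group A" and "group_exponent A = k" and "k dvd q - 1"
    and "finite_p_group p B"
    and "finite_dimensional_vector_space scale Basis"
    and "\<rho> \<in> hom (A \<times>\<times> B) (GL scale)"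
  shows "max_covering_codim scale (A \<times>\<times> B) \<rho> = 0"
proof -
  interpret finite_dimensional_vector_space scale Basis by fact
  interpret A: comm_group A by fact
  interpret B: group B using assms(8) by (simp add: finite_p_group_def)
  let ?G = "A \<times>\<times> B"
  interpret G: group ?G by (rule DirProd_group) unfold_locales
  obtain m where m: "order B = p ^ m" using assms(8) by (auto simp: finite_p_group_def)
  have finV: "finite X" for X :: "'v set"
    using finite_UNIV_if_finite_field[OF finite] finite_subset subset_UNIV by blast
  have p0: "of_nat p = (0 :: 'k)"
    using of_nat_card_eq_0[where ?'k = 'k] assms(3,4) by simp
  \<comment> \<open>This makes the natural number \<open>q - 1\<close> positive, which rules out
    exponent 0.\<close>
  have "q > 1" using assms(1-3) by (metis one_less_power prime_gt_1_nat)
  then have exp: "a [^]\<^bsub>A\<^esub> (q - 1) = \<one>\<^bsub>A\<^esub>" if "a \<in> carrier A" for a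
    using group_exponent_pow_eq_one[OF A.is_group] assms(6,7) that by simp
  have lin: "Vector_Spaces.linear scale scale (\<rho> g)" "bij (\<rho> g)" if "g \<in> carrier ?G" for g
    using assms(10) that by (auto simp: hom_def GL_def)
  have mult: "\<rho> (g \<otimes>\<^bsub>?G\<^esub> h) v = \<rho> g (\<rho> h v)" if "g \<in> carrier ?G" "h \<in> carrier ?G" for g h v
    using assms(10) that unfolding hom_def GL_def by auto
  have one: "\<rho> \<one>\<^bsub>?G\<^esub> v = v" for v
    using mult[of "\<one>\<^bsub>?G\<^esub>" "\<one>\<^bsub>?G\<^esub>" v] lin(2)[OF G.one_closed] by (simp add: bij_is_inj inj_eq)
  have \<rho>_zero: "\<rho> g 0 = 0"
    and \<rho>_add: "\<rho> g (x + y) = \<rho> g x + \<rho> g y"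
    and \<rho>_diff: "\<rho> g (x - y) = \<rho> g x - \<rho> g y"
    and \<rho>_scale: "\<rho> g (scale c x) = scale c (\<rho> g x)"
    if g: "g \<in> carrier ?G" for g c x y
  proof -
    interpret L: Vector_Spaces.linear scale scale "\<rho> g" by (rule lin(1)[OF g])
    show "\<rho> g 0 = 0" "\<rho> g (x + y) = \<rho> g x + \<rho> g y" "\<rho> g (x - y) = \<rho> g x - \<rho> g y"
      "\<rho> g (scale c x) = scale c (\<rho> g x)"
      by (fact L.zero L.add L.diff L.scale)+
  qed
  define stable where
    "stable X \<longleftrightarrow> subspace X \<and> (\<forall>g\<in>carrier ?G. \<forall>v\<in>X. \<rho> g v \<in> X)" for X
  have "U = UNIV" if U: "covering_subspace scale ?G \<rho> U" for U
  proof (rule ccontr)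
    assume "U \<noteq> UNIV"
    have subU: "subspace U" using U by (simp add: covering_subspace_def)
    \<comment> \<open>The intersection of all translates of \<open>U\<close>, which is the largest
      stable subspace inside \<open>U\<close>.\<close>
    define N where "N = {v. \<forall>g\<in>carrier ?G. \<rho> g v \<in> U}"
    have NU: "N \<subseteq> U" 
    proof
      fix v assume "v \<in> N"
      then have "\<forall>g\<in>carrier ?G. \<rho> g v \<in> U" by (simp only: N_def mem_Collect_eq)
      from bspec[OF this G.one_closed] show "v \<in> U" by (simp only: one)
    qed
    have stN: "stable N"
    proof -
      have "subspace N"
      proof (rule subspaceI)
        show "0 \<in> N" using \<rho>_zero subspace_0[OF subU] by (simp add: N_def)
        show "x + y \<in> N" if "x \<in> N" "y \<in> N" for x y
          using that \<rho>_add subspace_add[OF subU] by (simp add: N_def)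
        show "scale c x \<in> N" if "x \<in> N" for c x
          using that \<rho>_scale subspace_scale[OF subU] by (simp add: N_def)
      qed
      moreover have "\<rho> g v \<in> N" if g: "g \<in> carrier ?G" and v: "v \<in> N" for g v
      proof -
        have "\<rho> h (\<rho> g v) \<in> U" if h: "h \<in> carrier ?G" for h
          using v G.m_closed[OF h g] unfolding N_def mult[OF h g, symmetric] by blast
        then show ?thesis by (simp only: N_def mem_Collect_eq) blast
      qed
      ultimately show ?thesis by (simp add: stable_def)
    qed
    then have subN: "subspace N" by (simp add: stable_def)
    have "stable UNIV \<and> N \<subset> UNIV" using NU \<open>U \<noteq> UNIV\<close> by (auto simp: stable_def)
    \<comment> \<open>Minimality is taken with respect to cardinality. As all sets of vectors are
      finite, this implies minimality under inclusion, which is \<open>S_min\<close>.\<close>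
    from ex_has_least_nat[of "\<lambda>X. stable X \<and> N \<subset> X", OF this, of card]
    obtain S where S: "stable S" "N \<subset> S"
      and S_le: "\<And>X. stable X \<Longrightarrow> N \<subset> X \<Longrightarrow> card S \<le> card X" by blast
    have S_min: "S = X" if "stable X" "N \<subset> X" "X \<subseteq> S" for X
      using S_le[OF that(1,2)] that(3) card_seteq[OF finV] by blast
    have subS: "subspace S" using S(1) by (simp add: stable_def)
    let ?a = "\<lambda>a. (a, \<one>\<^bsub>B\<^esub>)" and ?b = "\<lambda>b. (\<one>\<^bsub>A\<^esub>, b)"
    have split: "\<rho> (a, b) v = \<rho> (?a a) (\<rho> (?b b) v)" if "a \<in> carrier A" "b \<in> carrier B" for a b v
      using mult[of "?a a" "?b b" v] that by simp

    have fix_B: "\<rho> (?b b) v - v \<in> N" if "b \<in> carrier B" "v \<in> S" for b v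
    proof -
      \<comment> \<open>The vectors whose coset modulo \<open>N\<close> is fixed by
        \<open>B\<close>. They form a stable subspace strictly larger than \<open>N\<close>, hence
        all of \<open>S\<close>.\<close>
      let ?F = "{v \<in> S. \<forall>b\<in>carrier B. \<rho> (?b b) v - v \<in> N}"
      have "(\<lambda>b. \<rho> (?b b)) \<in> hom B (GL scale)"
      proof (rule homI)
        fix b b' assume b: "b \<in> carrier B" "b' \<in> carrier B"
        show "\<rho> (?b (b \<otimes>\<^bsub>B\<^esub> b')) = \<rho> (?b b) \<otimes>\<^bsub>GL scale\<^esub> \<rho> (?b b')"
          using b mult[of "?b b" "?b b'"] by (simp add: GL_def fun_eq_iff)
      qed (use lin in \<open>auto simp: GL_def\<close>)
      then obtain w where "w \<in> S" "w \<notin> N" "\<And>b. b \<in> carrier B \<Longrightarrow> \<rho> (?b b) w - w \<in> N"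
      proof (rule p_group_fixed_coset[OF vector_space_axioms assms(1) p0 B.is_group m _ subS finV _ subN S(2)])
        show "\<rho> (?b b) v \<in> S" if "b \<in> carrier B" "v \<in> S" for b v
          using S(1) that by (simp add: stable_def)
        show "\<rho> (?b b) v \<in> N" if "b \<in> carrier B" "v \<in> N" for b v
          using stN that by (simp add: stable_def)
      qed blast
      moreover have "N \<subseteq> ?F"
        using S(2) stN subspace_diff[OF subN] by (auto simp: stable_def)
      moreover have "stable ?F"
        unfolding stable_def
      proof (intro conjI ballI)
        show "subspace ?F"
        proof (rule subspaceI)
          show "0 \<in> ?F" using subspace_0[OF subS] subspace_0[OF subN] \<rho>_zero by simp
          show "x + y \<in> ?F" if "x \<in> ?F" "y \<in> ?F" for x y
            using that subspace_add[OF subS] subspace_add[OF subN]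
            by (simp add: \<rho>_add add_diff_add)
          show "scale c x \<in> ?F" if "x \<in> ?F" for c x
            using that subspace_scale[OF subS] subspace_scale[OF subN]
            by (simp add: \<rho>_scale flip: scale_right_diff_distrib)
        qed
        fix g v assume g: "g \<in> carrier ?G" and v: "v \<in> ?F"
        obtain a b where ab: "g = (a, b)" "a \<in> carrier A" "b \<in> carrier B" using g by auto
        have "\<rho> (?b b') (\<rho> g v) - \<rho> g v \<in> N" if b': "b' \<in> carrier B" for b'
        proof -
          \<comment> \<open>Moving \<open>b'\<close> past \<open>g\<close> conjugates it by the
            \<open>B\<close>-component of \<open>g\<close>; the result is again in \<open>B\<close>,
            and \<open>v\<close> is fixed by it modulo \<open>N\<close>.\<close>
          let ?h = "inv\<^bsub>B\<^esub> b \<otimes>\<^bsub>B\<^esub> b' \<otimes>\<^bsub>B\<^esub> b"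
          have "?b b' \<otimes>\<^bsub>?G\<^esub> g = g \<otimes>\<^bsub>?G\<^esub> ?b ?h"
            using ab b' by (simp add: B.m_assoc[symmetric])
          then have "\<rho> (?b b') (\<rho> g v) = \<rho> g (\<rho> (?b ?h) v)"
            using mult[of "?b b'" g v] mult[of g "?b ?h" v] g ab b' by simp
          then have "\<rho> (?b b') (\<rho> g v) - \<rho> g v = \<rho> g (\<rho> (?b ?h) v - v)"
            using \<rho>_diff[OF g] by simp
          then show ?thesis using v ab b' g stN by (simp add: stable_def)
        qed
        then show "\<rho> g v \<in> ?F" using v g S(1) by (auto simp: stable_def)
      qed
      ultimately have "S = ?F" by (intro S_min) auto
      then show ?thesis using that by blast
    qed

    have scalar_A: "\<exists>c. c \<noteq> 0 \<and> (\<forall>v\<in>S. \<rho> (?a a) v - scale c v \<in> N)" if a: "a \<in> carrier A" for a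
    proof -
      have aG: "?a a \<in> carrier ?G" using a by simp
      have "(\<rho> (?a a) ^^ i) v = \<rho> (?a (a [^]\<^bsub>A\<^esub> i)) v" for i :: nat and v
      proof (induction i)
        case (Suc i)
        have "a [^]\<^bsub>A\<^esub> Suc i = a \<otimes>\<^bsub>A\<^esub> a [^]\<^bsub>A\<^esub> i" using a A.nat_pow_Suc2 by simp
        then show ?case using Suc mult[of "?a a" "?a (a [^]\<^bsub>A\<^esub> i)" v] a by simp
      qed (use one in simp)
      then have pow: "(\<rho> (?a a) ^^ (card (UNIV :: 'k set) - 1)) v = v" for v
        using exp[OF a] one assms(4) by simp
      obtain s where "s \<in> S" "s \<notin> N" using S(2) by blast
      then obtain c w where w: "c \<noteq> 0" "w \<in> S" "w \<notin> N" "\<rho> (?a a) w = scale c w"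
        using eigenvector_outside_subspace[OF lin(1)[OF aG] subS _ subN pow] S(1) aG
        by (auto simp: stable_def)
      \<comment> \<open>The vectors on which \<open>a\<close> acts as \<open>c\<close> modulo
        \<open>N\<close>. Stability holds because \<open>(a, 1)\<close> is central in the product,
        \<open>A\<close> being abelian.\<close>
      let ?E = "{v \<in> S. \<rho> (?a a) v - scale c v \<in> N}"
      have "w \<in> ?E" using w subspace_0[OF subN] by simp
      moreover have "N \<subseteq> ?E"
        using S(2) stN aG subspace_diff[OF subN] subspace_scale[OF subN] by (auto simp: stable_def)
      moreover have "stable ?E"
        unfolding stable_def
      proof (intro conjI ballI)
        note aadd = \<rho>_add[OF aG] and ascale = \<rho>_scale[OF aG]
        show "subspace ?E"
        proof (rule subspaceI)
          show "0 \<in> ?E"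
            using subspace_0[OF subS] subspace_0[OF subN] \<rho>_zero[OF aG] by simp
          show "x + y \<in> ?E" if "x \<in> ?E" "y \<in> ?E" for x y
            using that subspace_add[OF subS] subspace_add[OF subN]
            by (simp add: aadd scale_right_distrib add_diff_add)
          show "scale d x \<in> ?E" if "x \<in> ?E" for d x
            using that subspace_scale[OF subS] subspace_scale[OF subN, of "\<rho> (?a a) x - scale c x" d]
            by (simp add: ascale scale_right_diff_distrib mult.commute)
        qed
        fix g v assume g: "g \<in> carrier ?G" and v: "v \<in> ?E"
        have "?a a \<otimes>\<^bsub>?G\<^esub> g = g \<otimes>\<^bsub>?G\<^esub> ?a a" using g a A.m_comm by auto
        then have "\<rho> (?a a) (\<rho> g v) = \<rho> g (\<rho> (?a a) v)"
          using mult[OF aG g, of v] mult[OF g aG, of v] by metis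
        then have "\<rho> (?a a) (\<rho> g v) - scale c (\<rho> g v) = \<rho> g (\<rho> (?a a) v - scale c v)"
          using \<rho>_diff[OF g] \<rho>_scale[OF g] by simp
        then show "\<rho> g v \<in> ?E" using v g S(1) stN by (auto simp: stable_def)
      qed
      ultimately have "S = ?E" using w(3) by (intro S_min) auto
      then show ?thesis using w(1) by blast
    qed

    obtain v where v: "v \<in> S" "v \<notin> N" using S(2) by blast
    have scalar: "\<exists>c. c \<noteq> 0 \<and> \<rho> g v - scale c v \<in> N" if g: "g \<in> carrier ?G" for g
    proof -
      obtain a b where ab: "g = (a, b)" "a \<in> carrier A" "b \<in> carrier B" using g by auto
      have aG: "?a a \<in> carrier ?G" using ab by simp
      obtain c where c: "c \<noteq> 0" "\<rho> (?a a) v - scale c v \<in> N" using scalar_A[OF ab(2)] v(1) by blast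
      \<comment> \<open>With g = ab, the difference gv - cv is the sum of a(bv - v) and av - cv,
        both in \<open>N\<close>.\<close>
      have "\<rho> (?a a) (\<rho> (?b b) v - v) \<in> N"
        using fix_B[OF ab(3) v(1)] stN aG by (simp add: stable_def)
      then have "\<rho> (?a a) (\<rho> (?b b) v) - \<rho> (?a a) v \<in> N"
        using \<rho>_diff[OF aG] by simp
      from subspace_add[OF subN this c(2)] have "\<rho> g v - scale c v \<in> N"
        using split[OF ab(2,3)] ab(1) by simp
      then show ?thesis using c(1) by blast
    qed
    \<comment> \<open>Modulo \<open>N\<close>, hence modulo \<open>U\<close>, the vector gv is cv,
      and the nonzero scalar \<open>c\<close> can be divided out.\<close>
    have v_U: "v \<in> U" if g: "g \<in> carrier ?G" and "\<rho> g v \<in> U" for g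
    proof -
      obtain c where c: "c \<noteq> 0" "\<rho> g v - scale c v \<in> U" using scalar[OF g] NU by blast
      have "scale c v \<in> U" using subspace_diff[OF subU that(2) c(2)] by simp
      from subspace_scale[OF subU this, of "inverse c"] show ?thesis using c(1) by simp
    qed
    have "v \<notin> U"
    proof
      assume "v \<in> U"
      \<comment> \<open>Conversely, \<open>v\<close> in \<open>U\<close> would put its whole orbit
        in \<open>U\<close>, that is, \<open>v\<close> in \<open>N\<close>.\<close>
      have "\<rho> g v \<in> U" if g: "g \<in> carrier ?G" for g
      proof -
        obtain c where "\<rho> g v - scale c v \<in> U" using scalar[OF g] NU by blast
        from subspace_add[OF subU this subspace_scale[OF subU \<open>v \<in> U\<close>, of c]] show ?thesis by simp
      qed
      then show False using v(2) by (simp add: N_def)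
    qed
    have "v \<in> (\<Union>g\<in>carrier ?G. \<rho> g ` U)" using U by (simp add: covering_subspace_def)
    then obtain g u where g: "g \<in> carrier ?G" and u: "u \<in> U" "v = \<rho> g u" by blast
    \<comment> \<open>Covering moves \<open>v\<close> into \<open>U\<close> by the inverse of
      \<open>g\<close>, which \<open>v_U\<close> turns into \<open>v\<close> in
      \<open>U\<close>.\<close>
    have "\<rho> (inv\<^bsub>?G\<^esub> g) v = u"
      using mult[OF G.inv_closed[OF g] g, of u] G.l_inv[OF g] one u(2) by metis
    then show False using v_U[OF G.inv_closed[OF g]] u(1) \<open>v \<notin> U\<close> by simp
  qed
  \<comment> \<open>The maximum is thus over the single codimension 0 of the whole space.\<close>
  then have "{U. covering_subspace scale ?G \<rho> U} = {UNIV}"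
    using covering_subspace_UNIV[OF vector_space_axioms G.is_group assms(10)] by blast
  then show ?thesis by (simp add: max_covering_codim_def codim_def)
qed

end
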